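(* Let $\mathbf V$ be a variety with RexDFC (right existentially definable factor congruences). If $\mathbf V$ is stable by complements, then $\mathbf V$ has the Fraser-Horn property.
   Context: All algebras are assumed to have a type consisting of finitely many function symbols, each of finite arity. A variety with $\vec 0$ and $\vec 1$ is a variety $\mathbf V$ for which there are $0$-ary terms $0_1,\dots,0_n,1_1,\dots,1_n$ such that $\mathbf V\models \vec 0\approx\vec 1\rightarrow x\approx y$, where $\vec 0=(0_1,\dots,0_n)$, $\vec 1=(1_1,\dots,1_n)$. For $\vec a\in A^n$, $\vec b\in B^n$, $[\vec a,\vec b]$ denotes $((a_1,b_1),\dots,(a_n,b_n))\in(A\times B)^n$. For a homomorphism $f:A\to B$ and $\vec e\in A^n$, $f(\vec e)=(f(e_1),\dots,f(e_n))$. Let $A\in\mathbf V$. A tuple $\vec e\in A^n$ is a central element of $A$ if there is an isomorphism $\tau:A\to A_1\times A_2$ with $\tau(\vec e)=[\vec 0,\vec 1]$; $Z(A)$ is the set of central elements. $\vec e$ and $\vec f$ are complementary central elements, written $\vec e\diamond_A\vec f$, if there is an isomorphism $\tau:A\to A_1\times A_2$ with $\tau(\vec e)=[\vec 0,\vec 1]$ and $\tau(\vec f)=[\vec 1,\vec 0]$. Congruences $\theta,\delta$ of $A$ are complementary factor congruences if $\theta\cap\delta=\Delta$ (identity) and $\theta\circ\delta=\nabla$ (universal); each is then called a factor congruence. $\mathbf V$ has Boolean factor congruences (BFC) if for every $A\in\mathbf V$ the set of factor congruences of $A$ is a Boolean sublattice of the congruence lattice of $A$. $\mathbf V$ has RexDFC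 if it is a variety with $\vec 0$ and $\vec 1$ having BFC and there is an existential first order formula $\lambda(\vec z,x,y)$ such that for every $A,B\in\mathbf V$, $a,b\in A$, $c,d\in B$: $A\times B\models\lambda([\vec 0,\vec 1],(a,c),(b,d))$ iff $c=d$. A homomorphism $f:A\to B$ between members of $\mathbf V$ preserves complementary central elements if $f(\vec e)\in Z(B)$ for all $\vec e\in Z(A)$ and $\vec e_1\diamond_A\vec e_2$ implies $f(\vec e_1)\diamond_B f(\vec e_2)$. $\mathbf V$ is stable by complements if every homomorphism of $\mathbf V$ preserves complementary central elements. A variety has the Fraser-Horn property (FHP) if every congruence $\delta$ on a (finite) direct product of its algebras factorizes; for a product $A_1\times A_2$ this means there are $\delta_i\subseteq A_i\times A_i$ ($i=1,2$) with $\delta=\{((a,b),(c,d))\mid (a,c)\in\delta_1,\ (b,d)\in\delta_2\}$. *)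

theory Defs
  imports Main "HOL-Library.FuncSet"
begin

section \<open>Algebras, terms and varieties\<close>

record 'f signat =
  symbols :: "'f set"
  arity :: "'f \<Rightarrow> nat"

text \<open>
  The value of \<open>interp A f xs\<close> only matters when \<open>f\<close> is a symbol, \<open>xs\<close> has length \<open>arity f\<close>
  and its entries lie in the carrier; everything below is relativised accordingly.
\<close>

record ('f, 'a) algebra =
  carrier :: "'a set"
  interp :: "'f \<Rightarrow> 'a list \<Rightarrow> 'a"

definition args :: "'f signat \<Rightarrow> ('f, 'a) algebra \<Rightarrow> 'f \<Rightarrow> 'a list set" where
  "args S A f = {xs. length xs = arity S f \<and> set xs \<subseteq> carrier A}"

definition is_algebra :: "'f signat \<Rightarrow> ('f, 'a) algebra \<Rightarrow> bool" where
  "is_algebra S A \<longleftrightarrow> carrier A \<noteq> {} \<and>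
     (\<forall>f\<in>symbols S. \<forall>xs\<in>args S A f. interp A f xs \<in> carrier A)"

datatype 'f trm = Var nat | Fn 'f "'f trm list"

fun wf_trm :: "'f signat \<Rightarrow> 'f trm \<Rightarrow> bool" where
  "wf_trm S (Var v) \<longleftrightarrow> True"
| "wf_trm S (Fn f ts) \<longleftrightarrow> f \<in> symbols S \<and> length ts = arity S f \<and> (\<forall>t\<in>set ts. wf_trm S t)"

fun vars :: "'f trm \<Rightarrow> nat set" where
  "vars (Var v) = {v}"
| "vars (Fn f ts) = (\<Union>t\<in>set ts. vars t)"

primrec eval :: "('f, 'a) algebra \<Rightarrow> (nat \<Rightarrow> 'a) \<Rightarrow> 'f trm \<Rightarrow> 'a" where
  "eval A \<sigma> (Var v) = \<sigma> v"
| "eval A \<sigma> (Fn f ts) = interp A f (map (eval A \<sigma>) ts)"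

definition satisfies_id :: "('f, 'a) algebra \<Rightarrow> 'f trm \<times> 'f trm \<Rightarrow> bool" where
  "satisfies_id A e \<longleftrightarrow>
     (\<forall>\<sigma>. range \<sigma> \<subseteq> carrier A \<longrightarrow> eval A \<sigma> (fst e) = eval A \<sigma> (snd e))"

text \<open>
  A variety is an equational class, restricted to the algebras whose carrier is a subset of the
  type \<open>'u\<close>, which acts as the universe. (Closure under arbitrary direct products cannot be
  expressed inside one type.) If \<open>'u\<close> is infinite, this class is closed, up to isomorphism,
  under subalgebras, homomorphic images and finite products.
\<close>

definition variety :: "'f signat \<Rightarrow> ('f, 'u) algebra set \<Rightarrow> bool" where
  "variety S V \<longleftrightarrow>
     (\<exists>E. (\<forall>(s, t)\<in>E. wf_trm S s \<and> wf_trm S t) \<and>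
          V = {A. is_algebra S A \<and> (\<forall>e\<in>E. satisfies_id A e)})"


section \<open>Homomorphisms and products\<close>

definition hom :: "'f signat \<Rightarrow> ('f, 'a) algebra \<Rightarrow> ('f, 'b) algebra \<Rightarrow> ('a \<Rightarrow> 'b) set" where
  "hom S A B = {h. h ` carrier A \<subseteq> carrier B \<and>
     (\<forall>f\<in>symbols S. \<forall>xs\<in>args S A f. h (interp A f xs) = interp B f (map h xs))}"

definition iso :: "'f signat \<Rightarrow> ('f, 'a) algebra \<Rightarrow> ('f, 'b) algebra \<Rightarrow> ('a \<Rightarrow> 'b) set" where
  "iso S A B = {h \<in> hom S A B. bij_betw h (carrier A) (carrier B)}"

definition prod_alg ::
    "('f, 'a) algebra \<Rightarrow> ('f, 'b) algebra \<Rightarrow> ('f, 'a \<times> 'b) algebra" (infixr "\<times>\<^sub>a" 75) where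
  "A \<times>\<^sub>a B = \<lparr>carrier = carrier A \<times> carrier B,
     interp = (\<lambda>f xs. (interp A f (map fst xs), interp B f (map snd xs)))\<rparr>"

definition fam_prod :: "nat \<Rightarrow> (nat \<Rightarrow> ('f, 'a) algebra) \<Rightarrow> ('f, nat \<Rightarrow> 'a) algebra" where
  "fam_prod m A = \<lparr>carrier = (\<Pi>\<^sub>E i\<in>{..<m}. carrier (A i)),
     interp = (\<lambda>f xs. \<lambda>i\<in>{..<m}. interp (A i) f (map (\<lambda>x. x i) xs))\<rparr>"


section \<open>Congruences\<close>

definition congruence :: "'f signat \<Rightarrow> ('f, 'a) algebra \<Rightarrow> ('a \<times> 'a) set \<Rightarrow> bool" where
  "congruence S A \<theta> \<longleftrightarrow> equiv (carrier A) \<theta> \<and>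
     (\<forall>f\<in>symbols S. \<forall>xs\<in>args S A f. \<forall>ys\<in>args S A f.
        list_all2 (\<lambda>x y. (x, y) \<in> \<theta>) xs ys \<longrightarrow> (interp A f xs, interp A f ys) \<in> \<theta>)"

definition cong_join ::
    "'f signat \<Rightarrow> ('f, 'a) algebra \<Rightarrow> ('a \<times> 'a) set \<Rightarrow> ('a \<times> 'a) set \<Rightarrow> ('a \<times> 'a) set" where
  "cong_join S A \<theta> \<delta> = \<Inter>{\<gamma>. congruence S A \<gamma> \<and> \<theta> \<union> \<delta> \<subseteq> \<gamma>}"

definition compl_factor_congs ::
    "'f signat \<Rightarrow> ('f, 'a) algebra \<Rightarrow> ('a \<times> 'a) set \<Rightarrow> ('a \<times> 'a) set \<Rightarrow> bool" where
  "compl_factor_congs S A \<theta> \<delta> \<longleftrightarrow> congruence S A \<theta> \<and> congruence S A \<delta> \<and>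
     \<theta> \<inter> \<delta> = Id_on (carrier A) \<and> \<theta> O \<delta> = carrier A \<times> carrier A"

definition factor_congs :: "'f signat \<Rightarrow> ('f, 'a) algebra \<Rightarrow> ('a \<times> 'a) set set" where
  "factor_congs S A = {\<theta>. \<exists>\<delta>. compl_factor_congs S A \<theta> \<delta>}"

text \<open>The meet of two congruences in the congruence lattice is their intersection.\<close>

definition boolean_sublattice ::
    "'f signat \<Rightarrow> ('f, 'a) algebra \<Rightarrow> ('a \<times> 'a) set set \<Rightarrow> bool" where
  "boolean_sublattice S A L \<longleftrightarrow>
     L \<subseteq> {\<theta>. congruence S A \<theta>} \<and>
     Id_on (carrier A) \<in> L \<and> carrier A \<times> carrier A \<in> L \<and>
     (\<forall>\<theta>\<in>L. \<forall>\<delta>\<in>L. \<theta> \<inter> \<delta> \<in> L \<and> cong_join S A \<theta> \<delta> \<in> L) \<and>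
     (\<forall>\<theta>\<in>L. \<forall>\<delta>\<in>L. \<forall>\<gamma>\<in>L.
        \<theta> \<inter> cong_join S A \<delta> \<gamma> = cong_join S A (\<theta> \<inter> \<delta>) (\<theta> \<inter> \<gamma>)) \<and>
     (\<forall>\<theta>\<in>L. \<exists>\<delta>\<in>L.
        \<theta> \<inter> \<delta> = Id_on (carrier A) \<and> cong_join S A \<theta> \<delta> = carrier A \<times> carrier A)"

definition BFC :: "'f signat \<Rightarrow> ('f, 'u) algebra set \<Rightarrow> bool" where
  "BFC S V \<longleftrightarrow> (\<forall>A\<in>V. boolean_sublattice S A (factor_congs S A))"


section \<open>First order formulas\<close>

datatype 'f fm =
    Eq "'f trm" "'f trm"
  | Neg "'f fm"
  | Conj "'f fm" "'f fm"
  | Disj "'f fm" "'f fm"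
  | Ex nat "'f fm"
  | All nat "'f fm"

primrec wf_fm :: "'f signat \<Rightarrow> 'f fm \<Rightarrow> bool" where
  "wf_fm S (Eq s t) \<longleftrightarrow> wf_trm S s \<and> wf_trm S t"
| "wf_fm S (Neg p) \<longleftrightarrow> wf_fm S p"
| "wf_fm S (Conj p q) \<longleftrightarrow> wf_fm S p \<and> wf_fm S q"
| "wf_fm S (Disj p q) \<longleftrightarrow> wf_fm S p \<and> wf_fm S q"
| "wf_fm S (Ex v p) \<longleftrightarrow> wf_fm S p"
| "wf_fm S (All v p) \<longleftrightarrow> wf_fm S p"

primrec free_vars :: "'f fm \<Rightarrow> nat set" where
  "free_vars (Eq s t) = vars s \<union> vars t"
| "free_vars (Neg p) = free_vars p"
| "free_vars (Conj p q) = free_vars p \<union> free_vars q"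
| "free_vars (Disj p q) = free_vars p \<union> free_vars q"
| "free_vars (Ex v p) = free_vars p - {v}"
| "free_vars (All v p) = free_vars p - {v}"

primrec sat :: "('f, 'a) algebra \<Rightarrow> 'f fm \<Rightarrow> (nat \<Rightarrow> 'a) \<Rightarrow> bool" where
  "sat A (Eq s t) \<sigma> \<longleftrightarrow> eval A \<sigma> s = eval A \<sigma> t"
| "sat A (Neg p) \<sigma> \<longleftrightarrow> \<not> sat A p \<sigma>"
| "sat A (Conj p q) \<sigma> \<longleftrightarrow> sat A p \<sigma> \<and> sat A q \<sigma>"
| "sat A (Disj p q) \<sigma> \<longleftrightarrow> sat A p \<sigma> \<or> sat A q \<sigma>"
| "sat A (Ex v p) \<sigma> \<longleftrightarrow> (\<exists>a\<in>carrier A. sat A p (\<sigma>(v := a)))"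
| "sat A (All v p) \<sigma> \<longleftrightarrow> (\<forall>a\<in>carrier A. sat A p (\<sigma>(v := a)))"

primrec quantifier_free :: "'f fm \<Rightarrow> bool" where
  "quantifier_free (Eq s t) \<longleftrightarrow> True"
| "quantifier_free (Neg p) \<longleftrightarrow> quantifier_free p"
| "quantifier_free (Conj p q) \<longleftrightarrow> quantifier_free p \<and> quantifier_free q"
| "quantifier_free (Disj p q) \<longleftrightarrow> quantifier_free p \<and> quantifier_free q"
| "quantifier_free (Ex v p) \<longleftrightarrow> False"
| "quantifier_free (All v p) \<longleftrightarrow> False"

inductive existential :: "'f fm \<Rightarrow> bool" where
  "quantifier_free p \<Longrightarrow> existential p"
| "existential p \<Longrightarrow> existential (Ex v p)"


section \<open>Varieties with constants 0 and 1, central elements\<close>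

text \<open>The valuation is irrelevant because this is only used for closed terms.\<close>

definition const_tuple :: "('f, 'a) algebra \<Rightarrow> 'f trm list \<Rightarrow> 'a list" where
  "const_tuple A ts = map (eval A (\<lambda>_. undefined)) ts"

text \<open>
  The tuples of 0-ary terms \<open>0\<^sub>1, \<dots>, 0\<^sub>n\<close> and \<open>1\<^sub>1, \<dots>, 1\<^sub>n\<close> are
  lists \<open>zs\<close> and \<open>us\<close> of the same length \<open>n \<ge> 1\<close>. For tuples
  \<open>a\<close>, \<open>b\<close> of equal length, \<open>[a, b]\<close> is \<open>zip a b\<close>.
\<close>

definition variety_with_01 ::
    "'f signat \<Rightarrow> ('f, 'u) algebra set \<Rightarrow> 'f trm list \<Rightarrow> 'f trm list \<Rightarrow> bool" where
  "variety_with_01 S V zs us \<longleftrightarrow> variety S V \<and>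
     length zs = length us \<and> zs \<noteq> [] \<and>
     (\<forall>t\<in>set zs \<union> set us. wf_trm S t \<and> vars t = {}) \<and>
     (\<forall>A\<in>V. const_tuple A zs = const_tuple A us \<longrightarrow> (\<forall>x\<in>carrier A. \<forall>y\<in>carrier A. x = y))"

definition central ::
    "'f signat \<Rightarrow> ('f, 'u) algebra set \<Rightarrow> 'f trm list \<Rightarrow> 'f trm list \<Rightarrow>
      ('f, 'u) algebra \<Rightarrow> 'u list set" where
  "central S V zs us A =
     {e. length e = length zs \<and> set e \<subseteq> carrier A \<and>
        (\<exists>A\<^sub>1\<in>V. \<exists>A\<^sub>2\<in>V. \<exists>\<tau>\<in>iso S A (A\<^sub>1 \<times>\<^sub>a A\<^sub>2).
           map \<tau> e = zip (const_tuple A\<^sub>1 zs) (const_tuple A\<^sub>2 us))}"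

definition compl_central ::
    "'f signat \<Rightarrow> ('f, 'u) algebra set \<Rightarrow> 'f trm list \<Rightarrow> 'f trm list \<Rightarrow>
      ('f, 'u) algebra \<Rightarrow> 'u list \<Rightarrow> 'u list \<Rightarrow> bool" where
  "compl_central S V zs us A e e' \<longleftrightarrow>
     length e = length zs \<and> set e \<subseteq> carrier A \<and>
     length e' = length zs \<and> set e' \<subseteq> carrier A \<and>
     (\<exists>A\<^sub>1\<in>V. \<exists>A\<^sub>2\<in>V. \<exists>\<tau>\<in>iso S A (A\<^sub>1 \<times>\<^sub>a A\<^sub>2).
        map \<tau> e = zip (const_tuple A\<^sub>1 zs) (const_tuple A\<^sub>2 us) \<and>
        map \<tau> e' = zip (const_tuple A\<^sub>1 us) (const_tuple A\<^sub>2 zs))"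

definition preserves_compl_central ::
    "'f signat \<Rightarrow> ('f, 'u) algebra set \<Rightarrow> 'f trm list \<Rightarrow> 'f trm list \<Rightarrow>
      ('f, 'u) algebra \<Rightarrow> ('f, 'u) algebra \<Rightarrow> ('u \<Rightarrow> 'u) \<Rightarrow> bool" where
  "preserves_compl_central S V zs us A B h \<longleftrightarrow>
     (\<forall>e\<in>central S V zs us A. map h e \<in> central S V zs us B) \<and>
     (\<forall>e e'. compl_central S V zs us A e e' \<longrightarrow>
        compl_central S V zs us B (map h e) (map h e'))"

definition stable_by_complements ::
    "'f signat \<Rightarrow> ('f, 'u) algebra set \<Rightarrow> 'f trm list \<Rightarrow> 'f trm list \<Rightarrow> bool" where
  "stable_by_complements S V zs us \<longleftrightarrow>
     (\<forall>A\<in>V. \<forall>B\<in>V. \<forall>h\<in>hom S A B. preserves_compl_central S V zs us A B h)"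


section \<open>Existentially definable factor congruences and the Fraser-Horn property\<close>

text \<open>
  In the formula \<open>\<lambda>(z, x, y)\<close> the variables \<open>0, \<dots>, n - 1\<close> stand for \<open>z\<close>, and
  \<open>n\<close>, \<open>n + 1\<close> for \<open>x\<close>, \<open>y\<close>. The valuation given by a list of length
  \<open>n + 2\<close> is arbitrary beyond \<open>n + 1\<close>, where no variable is free.
\<close>

definition RexDFC ::
    "'f signat \<Rightarrow> ('f, 'u) algebra set \<Rightarrow> 'f trm list \<Rightarrow> 'f trm list \<Rightarrow> bool" where
  "RexDFC S V zs us \<longleftrightarrow> variety_with_01 S V zs us \<and> BFC S V \<and>
     (\<exists>p. wf_fm S p \<and> existential p \<and> free_vars p \<subseteq> {..<length zs + 2} \<and>
        (\<forall>A\<in>V. \<forall>B\<in>V. \<forall>a\<in>carrier A. \<forall>b\<in>carrier A. \<forall>c\<in>carrier B. \<forall>d\<in>carrier B.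
           sat (A \<times>\<^sub>a B) p
             (\<lambda>i. (zip (const_tuple A zs) (const_tuple B us) @ [(a, c), (b, d)]) ! i)
           \<longleftrightarrow> c = d))"

text \<open>
  Congruences on all finite direct products factorize. Products of two algebras are
  additionally stated with pairs, since \<open>fam_prod 2\<close> is only isomorphic to them.
\<close>

definition fraser_horn :: "'f signat \<Rightarrow> ('f, 'u) algebra set \<Rightarrow> bool" where
  "fraser_horn S V \<longleftrightarrow>
     (\<forall>A\<^sub>1\<in>V. \<forall>A\<^sub>2\<in>V. \<forall>\<delta>. congruence S (A\<^sub>1 \<times>\<^sub>a A\<^sub>2) \<delta> \<longrightarrow>
        (\<exists>\<delta>\<^sub>1 \<delta>\<^sub>2. \<delta>\<^sub>1 \<subseteq> carrier A\<^sub>1 \<times> carrier A\<^sub>1 \<and> \<delta>\<^sub>2 \<subseteq> carrier A\<^sub>2 \<times> carrier A\<^sub>2 \<and>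
           \<delta> = {((a, b), (c, d)) | a b c d. (a, c) \<in> \<delta>\<^sub>1 \<and> (b, d) \<in> \<delta>\<^sub>2})) \<and>
     (\<forall>m A \<delta>. (\<forall>i<m. A i \<in> V) \<longrightarrow> congruence S (fam_prod m A) \<delta> \<longrightarrow>
        (\<exists>D. (\<forall>i<m. D i \<subseteq> carrier (A i) \<times> carrier (A i)) \<and>
           \<delta> = {(x, y). x \<in> carrier (fam_prod m A) \<and> y \<in> carrier (fam_prod m A) \<and>
                        (\<forall>i<m. (x i, y i) \<in> D i)}))"

end

theory Submission
  imports Defs
begin

text \<open>
  Let \<open>\<delta>\<close> be a congruence of \<open>A \<times> B\<close>. By stability, the images of the complementary central elements
  \<open>[0, 1]\<close> and \<open>[1, 0]\<close> in the quotient by \<open>\<delta>\<close> are again complementary, so the quotient map becomes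
  a homomorphism \<open>h : A \<times> B \<rightarrow> C \<times> D\<close> that fixes \<open>[0, 1]\<close> and \<open>[1, 0]\<close>. Being existential, the formula
  \<open>\<lambda>\<close> is preserved by the embedding \<open>x \<mapsto> (x, h x)\<close> of \<open>A \<times> B\<close> into \<open>(A \<times> B) \<times> (C \<times> D)\<close>,
  although not necessarily by \<open>h\<close>. Regarding this product as \<open>(A \<times> C) \<times> (B \<times> D)\<close>, the embedding sends
  \<open>[0, 1]\<close> to \<open>[0, 1]\<close>; hence if \<open>x\<close> and \<open>y\<close> agree in \<open>B\<close>, then \<open>h x\<close> and \<open>h y\<close> agree in \<open>D\<close>.
  By symmetry \<open>h\<close> also respects the first coordinate, so its kernel \<open>\<delta>\<close> factorizes.
\<close>

section \<open>Homomorphisms\<close>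

lemma homI:
  assumes "\<And>x. x \<in> carrier A \<Longrightarrow> h x \<in> carrier B"
    and "\<And>f xs. f \<in> symbols S \<Longrightarrow> xs \<in> args S A f \<Longrightarrow> h (interp A f xs) = interp B f (map h xs)"
  shows "h \<in> hom S A B"
  using assms unfolding hom_def by blast

lemma hom_closed: "h \<in> hom S A B \<Longrightarrow> x \<in> carrier A \<Longrightarrow> h x \<in> carrier B"
  unfolding hom_def by blast

lemma hom_interp:
  "h \<in> hom S A B \<Longrightarrow> f \<in> symbols S \<Longrightarrow> xs \<in> args S A f
    \<Longrightarrow> h (interp A f xs) = interp B f (map h xs)"
  unfolding hom_def by blast

lemma hom_args: "h \<in> hom S A B \<Longrightarrow> xs \<in> args S A f \<Longrightarrow> map h xs \<in> args S B f"
  unfolding hom_def args_def by (force simp: image_subset_iff)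

lemma hom_comp: "h \<in> hom S A B \<Longrightarrow> k \<in> hom S B C \<Longrightarrow> (\<lambda>x. k (h x)) \<in> hom S A C"
  by (rule homI) (simp_all add: hom_closed hom_interp hom_args comp_def)

lemma fst_hom: "fst \<in> hom S (A \<times>\<^sub>a B) A"
  by (rule homI) (auto simp: prod_alg_def)

lemma snd_hom: "snd \<in> hom S (A \<times>\<^sub>a B) B"
  by (rule homI) (auto simp: prod_alg_def)

lemma pair_hom:
  "h \<in> hom S P A \<Longrightarrow> k \<in> hom S P B \<Longrightarrow> (\<lambda>x. (h x, k x)) \<in> hom S P (A \<times>\<^sub>a B)"
  by (rule homI) (auto simp: prod_alg_def hom_closed hom_interp comp_def)

lemma carrier_prod [simp]: "carrier (A \<times>\<^sub>a B) = carrier A \<times> carrier B"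
  by (simp add: prod_alg_def)

lemma carrier_fam_prod [simp]: "carrier (fam_prod m A) = (\<Pi>\<^sub>E i\<in>{..<m}. carrier (A i))"
  by (simp add: fam_prod_def)

lemma interp_prod:
  "interp (A \<times>\<^sub>a B) f xs = (interp A f (map fst xs), interp B f (map snd xs))"
  by (simp add: prod_alg_def)

lemma interp_fam_prod:
  "i < m \<Longrightarrow> interp (fam_prod m A) f xs i = interp (A i) f (map (\<lambda>x. x i) xs)"
  by (simp add: fam_prod_def)

lemma proj_hom: "k < m \<Longrightarrow> (\<lambda>x. x k) \<in> hom S (fam_prod m A) (A k)"
  by (rule homI) (auto simp: fam_prod_def)

lemma algebra_interp_closed:
  "is_algebra S A \<Longrightarrow> f \<in> symbols S \<Longrightarrow> xs \<in> args S A f \<Longrightarrow> interp A f xs \<in> carrier A"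
  unfolding is_algebra_def by blast

text \<open>Argument tuples in \<open>Q\<close> lift entrywise through the surjection
  \<open>q\<close> to \<open>P\<close>, where \<open>h\<close> already commutes with the operations.
  Since \<open>P\<close> is closed under them, \<open>k\<close> is known at the resulting value
  too.\<close>

lemma hom_factor:
  assumes q: "q \<in> hom S P Q" and surj: "q ` carrier P = carrier Q" and h: "h \<in> hom S P R"
    and alg: "is_algebra S P"
    and k: "\<And>x. x \<in> carrier P \<Longrightarrow> k (q x) = h x"
  shows "k \<in> hom S Q R"
proof (rule homI)
  fix y assume "y \<in> carrier Q"
  then show "k y \<in> carrier R" using surj k hom_closed[OF h] by (metis imageE)
next
  fix f ys assume f: "f \<in> symbols S" and ys: "ys \<in> args S Q f"
  have "\<forall>y\<in>set ys. \<exists>x\<in>carrier P. q x = y" using ys unfolding args_def surj[symmetric] by auto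
  then obtain g where g: "\<And>y. y \<in> set ys \<Longrightarrow> g y \<in> carrier P \<and> q (g y) = y" by metis
  have xs: "map g ys \<in> args S P f" using ys g unfolding args_def by auto
  have ys_eq: "ys = map q (map g ys)" using g by (simp add: map_idI)
  have "k (interp Q f ys) = k (q (interp P f (map g ys)))"
    using hom_interp[OF q f xs] ys_eq by simp
  also have "\<dots> = h (interp P f (map g ys))"
    using k algebra_interp_closed[OF alg f xs] by simp
  also have "\<dots> = interp R f (map h (map g ys))" by (rule hom_interp[OF h f xs])
  also have "map h (map g ys) = map k ys" using g k[symmetric] by simp
  finally show "k (interp Q f ys) = interp R f (map k ys)" .
qed

text \<open>The inverse is what \<open>hom_factor\<close> yields when the identity of
  \<open>P\<close> is factored through \<open>h\<close>.\<close>

lemma inv_hom: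
  assumes "h \<in> iso S P Q" and "is_algebra S P"
  shows "inv_into (carrier P) h \<in> iso S Q P"
proof -
  have h: "h \<in> hom S P Q" and bij: "bij_betw h (carrier P) (carrier Q)"
    using assms(1) unfolding iso_def by auto
  have "(\<lambda>x. x) \<in> hom S P P" by (rule homI) simp_all
  then have "inv_into (carrier P) h \<in> hom S Q P"
    by (rule hom_factor[OF h _ _ assms(2), rotated]) (use bij in \<open>auto simp: bij_betw_def\<close>)
  then show ?thesis using bij_betw_inv_into[OF bij] unfolding iso_def by blast
qed

section \<open>Terms and existential formulas\<close>

lemma eval_cong: "(\<And>v. v \<in> vars t \<Longrightarrow> \<sigma> v = \<sigma>' v) \<Longrightarrow> eval A \<sigma> t = eval A \<sigma>' t"
proof (induction t)
  case (Fn f ts)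
  then have "map (eval A \<sigma>) ts = map (eval A \<sigma>') ts" by auto
  then show ?case by (simp only: eval.simps)
qed simp

lemma eval_closed:
  assumes "is_algebra S A"
  shows "wf_trm S t \<Longrightarrow> (\<And>v. v \<in> vars t \<Longrightarrow> \<sigma> v \<in> carrier A) \<Longrightarrow> eval A \<sigma> t \<in> carrier A"
proof (induction t)
  case (Fn f ts)
  then have "map (eval A \<sigma>) ts \<in> args S A f" unfolding args_def by auto
  then show ?case using Fn.prems algebra_interp_closed[OF assms] by simp
qed simp

text \<open>Only the variables of \<open>t\<close> are constrained, so for closed terms both
  valuations are arbitrary. This is why the \<open>undefined\<close> valuation in
  \<open>const_tuple\<close> does no harm.\<close>

lemma hom_eval:
  assumes "is_algebra S A" and "h \<in> hom S A B"
  shows "wf_trm S t \<Longrightarrow> (\<And>v. v \<in> vars t \<Longrightarrow> \<sigma> v \<in> carrier A \<and> \<sigma>' v = h (\<sigma> v))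
    \<Longrightarrow> eval B \<sigma>' t = h (eval A \<sigma> t)"
proof (induction t)
  case (Fn f ts)
  have "map (eval A \<sigma>) ts \<in> args S A f"
    using Fn.prems unfolding args_def by (auto intro!: eval_closed[OF assms(1)])
  then have "h (interp A f (map (eval A \<sigma>) ts)) = interp B f (map h (map (eval A \<sigma>) ts))"
    using Fn.prems hom_interp[OF assms(2)] by simp
  moreover have "eval B \<sigma>' t = h (eval A \<sigma> t)" if "t \<in> set ts" for t
    using Fn that by auto
  then have "map h (map (eval A \<sigma>) ts) = map (eval B \<sigma>') ts" by simp
  ultimately show ?case by (simp only: eval.simps)
qed simp

lemma eval_prod: "eval (A \<times>\<^sub>a B) \<sigma> t = (eval A (\<lambda>v. fst (\<sigma> v)) t, eval B (\<lambda>v. snd (\<sigma> v)) t)"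
proof (induction t)
  case (Fn f ts)
  then have "map fst (map (eval (A \<times>\<^sub>a B) \<sigma>) ts) = map (eval A (\<lambda>v. fst (\<sigma> v))) ts"
    and "map snd (map (eval (A \<times>\<^sub>a B) \<sigma>) ts) = map (eval B (\<lambda>v. snd (\<sigma> v))) ts" by auto
  then show ?case by (simp only: eval.simps interp_prod)
qed simp

lemma eval_fam_prod: "i < m \<Longrightarrow> eval (fam_prod m A) \<sigma> t i = eval (A i) (\<lambda>v. \<sigma> v i) t"
proof (induction t)
  case (Fn f ts)
  then have "map (\<lambda>x. x i) (map (eval (fam_prod m A) \<sigma>) ts) = map (eval (A i) (\<lambda>v. \<sigma> v i)) ts"
    by auto
  then show ?case using Fn.prems by (simp only: eval.simps interp_fam_prod)
qed simp

text \<open>Any homomorphism preserves equations; injectivity also reflects them. The resulting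
  equivalence is what carries the induction through negations.\<close>

lemma quantifier_free_embedding:
  assumes "is_algebra S A" and "h \<in> hom S A B" and "inj_on h (carrier A)"
  shows "quantifier_free p \<Longrightarrow> wf_fm S p
    \<Longrightarrow> (\<And>v. v \<in> free_vars p \<Longrightarrow> \<sigma> v \<in> carrier A \<and> \<sigma>' v = h (\<sigma> v))
    \<Longrightarrow> sat A p \<sigma> \<longleftrightarrow> sat B p \<sigma>'"
proof (induction p)
  case (Eq s t)
  have "eval B \<sigma>' s = h (eval A \<sigma> s)" "eval B \<sigma>' t = h (eval A \<sigma> t)"
    using Eq.prems by (auto intro!: hom_eval[OF assms(1,2)])
  moreover have "eval A \<sigma> s \<in> carrier A" "eval A \<sigma> t \<in> carrier A"
    using Eq.prems by (auto intro!: eval_closed[OF assms(1)])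
  ultimately show ?case using assms(3) by (simp add: inj_on_eq_iff)
qed auto

text \<open>A witness in \<open>A\<close> is sent by \<open>h\<close> to a witness in
  \<open>B\<close>. Only this direction survives a quantifier, since a witness in \<open>B\<close>
  need not come from \<open>A\<close>.\<close>

lemma existential_embedding:
  assumes "is_algebra S A" and "h \<in> hom S A B" and "inj_on h (carrier A)"
  shows "existential p \<Longrightarrow> wf_fm S p
    \<Longrightarrow> (\<And>v. v \<in> free_vars p \<Longrightarrow> \<sigma> v \<in> carrier A \<and> \<sigma>' v = h (\<sigma> v))
    \<Longrightarrow> sat A p \<sigma> \<Longrightarrow> sat B p \<sigma>'"
proof (induction p arbitrary: \<sigma> \<sigma>' rule: existential.induct)
  case (1 p)
  then show ?case using quantifier_free_embedding[OF assms] by blast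
next
  case (2 p v)
  then obtain a where a: "a \<in> carrier A" "sat A p (\<sigma>(v := a))" by auto
  have "sat B p (\<sigma>'(v := h a))"
    by (rule "2.IH"[OF _ _ a(2)]) (use "2.prems" a(1) in auto)
  then show ?case using hom_closed[OF assms(2) a(1)] by auto
qed

section \<open>Tuples of constants under homomorphisms and products\<close>

lemma const_tuple_hom:
  assumes "is_algebra S A" and "h \<in> hom S A B" and "\<forall>t\<in>set ts. wf_trm S t \<and> vars t = {}"
  shows "map h (const_tuple A ts) = const_tuple B ts"
  using assms(3) unfolding const_tuple_def
  by (auto intro!: hom_eval[OF assms(1,2), symmetric])

lemma const_tuple_closed:
  assumes "is_algebra S A" and "\<forall>t\<in>set ts. wf_trm S t \<and> vars t = {}"
  shows "set (const_tuple A ts) \<subseteq> carrier A"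
  using assms(2) unfolding const_tuple_def by (auto intro!: eval_closed[OF assms(1)])

lemma length_const_tuple [simp]: "length (const_tuple A ts) = length ts"
  by (simp add: const_tuple_def)

lemma const_tuple_prod:
  assumes "\<forall>t\<in>set ts. vars t = {}"
  shows "const_tuple (A \<times>\<^sub>a B) ts = zip (const_tuple A ts) (const_tuple B ts)"
  using assms unfolding const_tuple_def
  by (auto simp: eval_prod zip_map_map zip_same_conv_map intro!: eval_cong)

section \<open>Algebras over other types that obey the identities of a variety\<close>

text \<open>Products of members of \<open>V\<close> live over other types and so cannot belong to
  \<open>V\<close>. The identities valid in \<open>V\<close> replace membership; all of them are
  taken because \<open>V\<close> does not come with a chosen set of defining equations.\<close>

definition satisfies_ids_of ::
    "'f signat \<Rightarrow> ('f, 'u) algebra set \<Rightarrow> ('f, 'a) algebra \<Rightarrow> bool" where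
  "satisfies_ids_of S V P \<longleftrightarrow> is_algebra S P \<and>
     (\<forall>s t. wf_trm S s \<longrightarrow> wf_trm S t \<longrightarrow> (\<forall>A\<in>V. satisfies_id A (s, t)) \<longrightarrow> satisfies_id P (s, t))"

text \<open>Any set of defining equations is among the identities valid in \<open>V\<close>, so over
  \<open>'u\<close> nothing is lost by the replacement.\<close>

lemma variety_iff_satisfies_ids:
  assumes "variety S V"
  shows "A \<in> V \<longleftrightarrow> satisfies_ids_of S V A"
proof -
  obtain E where E: "\<forall>(s, t)\<in>E. wf_trm S s \<and> wf_trm S t"
    and V: "V = {A. is_algebra S A \<and> (\<forall>e\<in>E. satisfies_id A e)}"
    using assms unfolding variety_def by blast
  show ?thesis
  proof
    assume "A \<in> V"
    then show "satisfies_ids_of S V A" unfolding satisfies_ids_of_def using V by auto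
  next
    assume A: "satisfies_ids_of S V A"
    have "satisfies_id A e" if "e \<in> E" for e
    proof -
      obtain s t where e: "e = (s, t)" by (cases e)
      then have "wf_trm S s" "wf_trm S t" "\<forall>B\<in>V. satisfies_id B (s, t)"
        using E V that by auto
      then show ?thesis using A e unfolding satisfies_ids_of_def by blast
    qed
    then show "A \<in> V" using A V unfolding satisfies_ids_of_def by blast
  qed
qed

lemma satisfies_ids_algebra: "satisfies_ids_of S V P \<Longrightarrow> is_algebra S P"
  unfolding satisfies_ids_of_def by blast

lemma satisfies_ids_prod:
  assumes "satisfies_ids_of S V A" and "satisfies_ids_of S V B"
  shows "satisfies_ids_of S V (A \<times>\<^sub>a B)"
proof -
  have alg: "is_algebra S A" "is_algebra S B" using assms by (auto dest: satisfies_ids_algebra)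
  have "interp (A \<times>\<^sub>a B) f xs \<in> carrier (A \<times>\<^sub>a B)"
    if f: "f \<in> symbols S" and xs: "xs \<in> args S (A \<times>\<^sub>a B) f" for f xs
    using algebra_interp_closed[OF alg(1) f hom_args[OF fst_hom xs]]
      algebra_interp_closed[OF alg(2) f hom_args[OF snd_hom xs]]
    by (simp add: prod_alg_def)
  then have "is_algebra S (A \<times>\<^sub>a B)" using alg unfolding is_algebra_def by auto
  moreover have "satisfies_id (A \<times>\<^sub>a B) (s, t)"
    if st: "satisfies_id A (s, t)" "satisfies_id B (s, t)" for s t
    unfolding satisfies_id_def
  proof (intro allI impI)
    fix \<sigma> :: "nat \<Rightarrow> _" assume "range \<sigma> \<subseteq> carrier (A \<times>\<^sub>a B)"
    then have "\<And>v. fst (\<sigma> v) \<in> carrier A \<and> snd (\<sigma> v) \<in> carrier B"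
      by (simp add: image_subset_iff mem_Times_iff)
    then have "range (\<lambda>v. fst (\<sigma> v)) \<subseteq> carrier A" "range (\<lambda>v. snd (\<sigma> v)) \<subseteq> carrier B" by auto
    then show "eval (A \<times>\<^sub>a B) \<sigma> (fst (s, t)) = eval (A \<times>\<^sub>a B) \<sigma> (snd (s, t))"
      using st unfolding eval_prod satisfies_id_def by simp
  qed
  ultimately show ?thesis using assms unfolding satisfies_ids_of_def by blast
qed

lemma satisfies_ids_fam_prod:
  assumes A: "\<And>i. i < m \<Longrightarrow> satisfies_ids_of S V (A i)"
  shows "satisfies_ids_of S V (fam_prod m A)"
proof -
  have alg: "is_algebra S (A i)" if "i < m" for i
    using A[OF that] by (rule satisfies_ids_algebra)
  have "interp (fam_prod m A) f xs \<in> carrier (fam_prod m A)"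
    if f: "f \<in> symbols S" and xs: "xs \<in> args S (fam_prod m A) f" for f xs
    using algebra_interp_closed[OF alg f hom_args[OF proj_hom xs]]
    by (auto simp: fam_prod_def)
  moreover have "carrier (fam_prod m A) \<noteq> {}"
    using alg by (auto simp: is_algebra_def PiE_eq_empty_iff)
  ultimately have P: "is_algebra S (fam_prod m A)" unfolding is_algebra_def by blast
  moreover have "satisfies_id (fam_prod m A) (s, t)"
    if wf: "wf_trm S s" "wf_trm S t" and st: "\<And>i. i < m \<Longrightarrow> satisfies_id (A i) (s, t)" for s t
    unfolding satisfies_id_def
  proof (intro allI impI)
    fix \<sigma> :: "nat \<Rightarrow> _" assume \<sigma>: "range \<sigma> \<subseteq> carrier (fam_prod m A)"
    \<comment> \<open>Elements of the product are extensional functions. Once well-formedness places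
      both values in the carrier, agreement below \<open>m\<close> suffices.\<close>
    have "eval (fam_prod m A) \<sigma> s = eval (fam_prod m A) \<sigma> t"
    proof (rule PiE_ext)
      show "eval (fam_prod m A) \<sigma> s \<in> (\<Pi>\<^sub>E i\<in>{..<m}. carrier (A i))"
        using eval_closed[OF P wf(1), of \<sigma>] \<sigma> by auto
      show "eval (fam_prod m A) \<sigma> t \<in> (\<Pi>\<^sub>E i\<in>{..<m}. carrier (A i))"
        using eval_closed[OF P wf(2), of \<sigma>] \<sigma> by auto
      fix i assume "i \<in> {..<m}"
      then have i: "i < m" by simp
      have "range (\<lambda>v. \<sigma> v i) \<subseteq> carrier (A i)" using \<sigma> i by (simp add: image_subset_iff PiE_iff)
      then show "eval (fam_prod m A) \<sigma> s i = eval (fam_prod m A) \<sigma> t i"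
        using st[OF i] unfolding eval_fam_prod[OF i] satisfies_id_def by simp
    qed
    then show "eval (fam_prod m A) \<sigma> (fst (s, t)) = eval (fam_prod m A) \<sigma> (snd (s, t))" by simp
  qed
  ultimately show ?thesis using A unfolding satisfies_ids_of_def by blast
qed

text \<open>Arguments and valuations in \<open>Q\<close> lift to \<open>P\<close> along chosen
  preimages \<open>g\<close>; closure and identities hold there and are carried to \<open>Q\<close>
  by \<open>h\<close>.\<close>

lemma satisfies_ids_image:
  assumes P: "satisfies_ids_of S V P"
    and h: "h \<in> hom S P Q" and surj: "h ` carrier P = carrier Q"
  shows "satisfies_ids_of S V Q"
proof -
  note algP = satisfies_ids_algebra[OF P]
  define g where "g = inv_into (carrier P) h"
  have g: "g y \<in> carrier P" "h (g y) = y" if "y \<in> carrier Q" for y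
    using that unfolding g_def surj[symmetric] by (simp_all add: inv_into_into f_inv_into_f)
  have "interp Q f ys \<in> carrier Q" if f: "f \<in> symbols S" and ys: "ys \<in> args S Q f" for f ys
  proof -
    have xs: "map g ys \<in> args S P f" using ys g unfolding args_def by auto
    have "map h (map g ys) = ys" using ys g unfolding args_def by (auto intro!: map_idI)
    then have "interp Q f ys = h (interp P f (map g ys))" using hom_interp[OF h f xs] by simp
    then show ?thesis using hom_closed[OF h algebra_interp_closed[OF algP f xs]] by simp
  qed
  moreover have "carrier Q \<noteq> {}" using surj algP unfolding is_algebra_def by blast
  ultimately have "is_algebra S Q" unfolding is_algebra_def by blast
  moreover have "satisfies_id Q (s, t)"
    if wf: "wf_trm S s" "wf_trm S t" and st: "satisfies_id P (s, t)" for s t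
    unfolding satisfies_id_def
  proof (intro allI impI)
    fix \<sigma> :: "nat \<Rightarrow> _" assume "range \<sigma> \<subseteq> carrier Q"
    then have "\<sigma> v \<in> carrier Q" for v by (simp add: image_subset_iff)
    then have \<sigma>: "g (\<sigma> v) \<in> carrier P" "\<sigma> v = h (g (\<sigma> v))" for v using g by simp_all
    then have "eval Q \<sigma> s = h (eval P (\<lambda>v. g (\<sigma> v)) s)"
      and "eval Q \<sigma> t = h (eval P (\<lambda>v. g (\<sigma> v)) t)"
      using wf by (auto intro!: hom_eval[OF algP h])
    moreover have "eval P (\<lambda>v. g (\<sigma> v)) s = eval P (\<lambda>v. g (\<sigma> v)) t"
      using st \<sigma>(1) unfolding satisfies_id_def by (simp add: image_subset_iff)
    ultimately show "eval Q \<sigma> (fst (s, t)) = eval Q \<sigma> (snd (s, t))" by simp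
  qed
  ultimately show ?thesis using P unfolding satisfies_ids_of_def by blast
qed

text \<open>Representatives of the classes, rather than the classes themselves, make up the quotient, so
  that it lives over the type \<open>'u\<close> again. The case of the identity relation transports \<open>P\<close> to \<open>'u\<close>.\<close>

lemma quotient_exists:
  fixes P :: "('f, 'a) algebra" and j :: "'a \<Rightarrow> 'u"
  assumes P: "is_algebra S P" and \<delta>: "congruence S P \<delta>" and j: "inj_on j (carrier P)"
  obtains Q :: "('f, 'u) algebra" and q where "q \<in> hom S P Q" "q ` carrier P = carrier Q"
    "\<And>x y. x \<in> carrier P \<Longrightarrow> y \<in> carrier P \<Longrightarrow> q x = q y \<longleftrightarrow> (x, y) \<in> \<delta>"
proof -
  have eq: "equiv (carrier P) \<delta>" using \<delta> unfolding congruence_def by blast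
  have refl: "(x, x) \<in> \<delta>" if "x \<in> carrier P" for x
    using eq that by (auto elim: equivE dest: refl_onD)
  have sym: "(y, x) \<in> \<delta>" if "(x, y) \<in> \<delta>" for x y
    using eq that by (auto elim: equivE dest: symD)
  have trans: "(x, z) \<in> \<delta>" if "(x, y) \<in> \<delta>" "(y, z) \<in> \<delta>" for x y z
    using eq that by (auto elim!: equivE dest: transD)
  \<comment> \<open>Related elements have the same candidates for a representative, so
    \<open>SOME\<close> returns the same one for both; \<open>j\<close> then places it in
    \<open>'u\<close>.\<close>
  define r where "r x = (SOME y. (x, y) \<in> \<delta>)" for x
  define q where "q x = j (r x)" for x
  define g where "g = inv_into (carrier P) q"
  \<comment> \<open>Operations are computed on the preimages chosen by \<open>g\<close>; since
    \<delta> is compatible with the operations, the class of the result does not depend on the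
    choice.\<close>
  define Q where "Q = \<lparr>carrier = q ` carrier P, interp = (\<lambda>f ys. q (interp P f (map g ys)))\<rparr>"
  have r: "(x, r x) \<in> \<delta>" "r x \<in> carrier P" if "x \<in> carrier P" for x
  proof -
    show "(x, r x) \<in> \<delta>" unfolding r_def using refl[OF that] by (rule someI)
    then show "r x \<in> carrier P" using equiv_type[OF eq] by blast
  qed
  have q_iff: "q x = q y \<longleftrightarrow> (x, y) \<in> \<delta>" if x: "x \<in> carrier P" and y: "y \<in> carrier P" for x y
  proof
    assume "q x = q y"
    then have "r x = r y" using j r x y unfolding q_def by (simp add: inj_on_eq_iff)
    then show "(x, y) \<in> \<delta>" using trans[OF r(1)[OF x] sym] r(1)[OF y] by simp
  next
    assume xy: "(x, y) \<in> \<delta>"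
    have "(x, z) \<in> \<delta> \<longleftrightarrow> (y, z) \<in> \<delta>" for z using trans[OF xy] trans[OF sym[OF xy]] by blast
    then show "q x = q y" unfolding q_def r_def by simp
  qed
  have g: "g (q x) \<in> carrier P" "(x, g (q x)) \<in> \<delta>" if "x \<in> carrier P" for x
  proof -
    show gx: "g (q x) \<in> carrier P" using that unfolding g_def by (simp add: inv_into_into)
    have "q (g (q x)) = q x" using that unfolding g_def by (simp add: f_inv_into_f)
    then show "(x, g (q x)) \<in> \<delta>" using q_iff[OF that gx] by simp
  qed
  have "q \<in> hom S P Q"
  proof (rule homI)
    fix f xs assume f: "f \<in> symbols S" and xs: "xs \<in> args S P f"
    have ys: "map (\<lambda>x. g (q x)) xs \<in> args S P f" using xs g unfolding args_def by auto
    have "list_all2 (\<lambda>x y. (x, y) \<in> \<delta>) xs (map (\<lambda>x. g (q x)) xs)"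
      using xs g unfolding args_def by (auto simp: list_all2_conv_all_nth subset_eq)
    then have "(interp P f xs, interp P f (map (\<lambda>x. g (q x)) xs)) \<in> \<delta>"
      using \<delta> f xs ys unfolding congruence_def by blast
    then show "q (interp P f xs) = interp Q f (map q xs)"
      using q_iff algebra_interp_closed[OF P f] xs ys by (simp add: Q_def comp_def)
  qed (simp add: Q_def)
  then show thesis by (rule that) (simp_all add: Q_def q_iff)
qed

section \<open>Kernels of homomorphisms and isomorphic copies over the universe\<close>

lemma congruence_Id_on: "congruence S P (Id_on (carrier P))" if "is_algebra S P"
proof -
  have "xs = ys" if "list_all2 (\<lambda>x y. (x, y) \<in> Id_on (carrier P)) xs ys" for xs ys
    using that by (intro nth_equalityI) (auto simp: list_all2_conv_all_nth)
  moreover have "equiv (carrier P) (Id_on (carrier P))"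
    by (auto simp: equiv_def refl_on_def sym_def trans_def)
  ultimately show ?thesis
    using algebra_interp_closed[OF that] unfolding congruence_def by blast
qed

text \<open>A family of homomorphisms is allowed so that the common kernel of all projections but
  one is covered.\<close>

lemma kernel_congruence:
  assumes P: "is_algebra S P" and h: "\<And>i. i \<in> I \<Longrightarrow> h i \<in> hom S P (A i)"
  shows "congruence S P {(x, y). x \<in> carrier P \<and> y \<in> carrier P \<and> (\<forall>i\<in>I. h i x = h i y)}"
    (is "congruence S P ?K")
proof -
  have "equiv (carrier P) ?K" by (auto simp: equiv_def refl_on_def sym_def trans_def)
  moreover have "(interp P f xs, interp P f ys) \<in> ?K"
    if f: "f \<in> symbols S" and xs: "xs \<in> args S P f" and ys: "ys \<in> args S P f"
      and rel: "list_all2 (\<lambda>x y. (x, y) \<in> ?K) xs ys" for f xs ys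
  proof -
    have "map (h i) xs = map (h i) ys" if "i \<in> I" for i
      using rel that by (auto simp: list_all2_conv_all_nth intro!: nth_equalityI)
    then have "h i (interp P f xs) = h i (interp P f ys)" if "i \<in> I" for i
      using hom_interp[OF h[OF that] f] xs ys that by simp
    then show ?thesis using algebra_interp_closed[OF P f] xs ys by blast
  qed
  ultimately show ?thesis unfolding congruence_def by blast
qed

text \<open>RexDFC and stability speak only of algebras over \<open>'u\<close>, so a product must be
  copied back into \<open>'u\<close> before they apply to it.\<close>

lemma copy_exists:
  fixes P :: "('f, 'a) algebra" and j :: "'a \<Rightarrow> 'u"
  assumes V: "variety S (V :: ('f, 'u) algebra set)" and P: "satisfies_ids_of S V P"
    and j: "inj_on j (carrier P)"
  obtains Q q where "Q \<in> V" "q \<in> iso S P Q"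
proof -
  note alg = satisfies_ids_algebra[OF P]
  obtain Q :: "('f, 'u) algebra" and q where q: "q \<in> hom S P Q" "q ` carrier P = carrier Q"
    "\<And>x y. x \<in> carrier P \<Longrightarrow> y \<in> carrier P \<Longrightarrow> q x = q y \<longleftrightarrow> (x, y) \<in> Id_on (carrier P)"
    by (rule quotient_exists[OF alg congruence_Id_on[OF alg] j]) (rule that)
  have "Q \<in> V" using variety_iff_satisfies_ids[OF V] satisfies_ids_image[OF P q(1,2)] by blast
  moreover have "inj_on q (carrier P)" by (rule inj_onI) (simp add: q(3) Id_on_iff)
  then have "q \<in> iso S P Q" using q(1,2) unfolding iso_def bij_betw_def by simp
  ultimately show thesis by (rule that)
qed

section \<open>Injections into an infinite type\<close>

text \<open>An infinite cardinal equals its square. Every use of the infinity of \<open>'u\<close>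
  comes down to this fact.\<close>

lemma inj_pair_exists:
  assumes "infinite (UNIV :: 'u set)"
  obtains j :: "'u \<times> 'u \<Rightarrow> 'u" where "inj j"
proof -
  have "\<exists>j :: 'u \<times> 'u \<Rightarrow> 'u. inj_on j (UNIV \<times> UNIV) \<and> j ` (UNIV \<times> UNIV) \<subseteq> UNIV"
    using card_of_Times_same_infinite[OF assms] unfolding card_of_ordLeq ordIso_iff_ordLeq
    by (rule conjunct1)
  then obtain j :: "'u \<times> 'u \<Rightarrow> 'u" where "inj_on j (UNIV \<times> UNIV)" by blast
  then show thesis by (intro that) simp
qed

text \<open>Iterated pairing: the first \<open>m\<close> coordinates are coded by the induction
  hypothesis, and the code is paired with the last coordinate.\<close>

lemma inj_PiE_exists:
  fixes C :: "nat \<Rightarrow> 'u set"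
  assumes "infinite (UNIV :: 'u set)"
  shows "\<exists>j :: (nat \<Rightarrow> 'u) \<Rightarrow> 'u. inj_on j (\<Pi>\<^sub>E i\<in>{..<m}. C i)"
proof (induction m)
  case 0
  show ?case by simp
next
  case (Suc m)
  then obtain j :: "(nat \<Rightarrow> 'u) \<Rightarrow> 'u" where j: "inj_on j (\<Pi>\<^sub>E i\<in>{..<m}. C i)" by blast
  obtain p :: "'u \<times> 'u \<Rightarrow> 'u" where p: "inj p" using inj_pair_exists[OF assms] .
  have "inj_on (\<lambda>x. p (j (restrict x {..<m}), x m)) (\<Pi>\<^sub>E i\<in>{..<Suc m}. C i)"
  proof (rule inj_onI)
    fix x y assume x: "x \<in> (\<Pi>\<^sub>E i\<in>{..<Suc m}. C i)" and y: "y \<in> (\<Pi>\<^sub>E i\<in>{..<Suc m}. C i)"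
      and "p (j (restrict x {..<m}), x m) = p (j (restrict y {..<m}), y m)"
    then have j_eq: "j (restrict x {..<m}) = j (restrict y {..<m})" and m: "x m = y m"
      using p by (auto dest: injD)
    have "restrict x {..<m} \<in> (\<Pi>\<^sub>E i\<in>{..<m}. C i)" "restrict y {..<m} \<in> (\<Pi>\<^sub>E i\<in>{..<m}. C i)"
      using x y by (auto simp: PiE_iff)
    then have "restrict x {..<m} = restrict y {..<m}" by (rule inj_onD[OF j, OF j_eq])
    then have "x i = y i" if "i < m" for i using that by (metis lessThan_iff restrict_apply')
    then have "x i = y i" if "i < Suc m" for i using m that by (cases "i = m") simp_all
    then show "x = y" by (intro PiE_ext[OF x y]) simp
  qed
  then show ?case by blast
qed

section \<open>Factorization of congruences\<close>

lemma map_zip_pair: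
  assumes "length xs = length ys"
    and "map g (zip xs ys) = zip xs' ys'" and "length xs' = length xs" and "length ys' = length xs"
  shows "map (\<lambda>x. fst (g x)) (zip xs ys) = xs'" and "map (\<lambda>x. snd (g x)) (zip xs ys) = ys'"
proof -
  have "map fst (map g (zip xs ys)) = xs'" "map snd (map g (zip xs ys)) = ys'"
    using assms by simp_all
  then show "map (\<lambda>x. fst (g x)) (zip xs ys) = xs'" and "map (\<lambda>x. snd (g x)) (zip xs ys) = ys'"
    by (simp_all add: comp_def)
qed

lemma hom_respects_snd:
  fixes V :: "('f, 'u) algebra set"
  assumes inf: "infinite (UNIV :: 'u set)" and R: "RexDFC S V zs us"
    and ABCD: "A \<in> V" "B \<in> V" "C \<in> V" "D \<in> V"
    and h: "h \<in> hom S (A \<times>\<^sub>a B) (C \<times>\<^sub>a D)"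
    and h01: "map h (zip (const_tuple A zs) (const_tuple B us))
      = zip (const_tuple C zs) (const_tuple D us)"
    and x: "x \<in> carrier (A \<times>\<^sub>a B)" and y: "y \<in> carrier (A \<times>\<^sub>a B)" and xy: "snd x = snd y"
  shows "snd (h x) = snd (h y)"
proof -
  have V: "variety S V" and len: "length zs = length us"
    and zs: "\<forall>t\<in>set zs. wf_trm S t \<and> vars t = {}" and us: "\<forall>t\<in>set us. wf_trm S t \<and> vars t = {}"
    using R unfolding RexDFC_def variety_with_01_def by auto
  obtain p where p: "wf_fm S p" "existential p" "free_vars p \<subseteq> {..<length zs + 2}"
    and sat_p: "\<And>A B a b c d. A \<in> V \<Longrightarrow> B \<in> V \<Longrightarrow> a \<in> carrier A \<Longrightarrow> b \<in> carrier A
      \<Longrightarrow> c \<in> carrier B \<Longrightarrow> d \<in> carrier B \<Longrightarrow> sat (A \<times>\<^sub>a B) p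
        (\<lambda>i. (zip (const_tuple A zs) (const_tuple B us) @ [(a, c), (b, d)]) ! i) \<longleftrightarrow> c = d"
    using R unfolding RexDFC_def by blast
  note ids = variety_iff_satisfies_ids[OF V, THEN iffD1]
  obtain j :: "'u \<times> 'u \<Rightarrow> 'u" where j: "inj j" using inj_pair_exists[OF inf] .
  have AC: "satisfies_ids_of S V (A \<times>\<^sub>a C)" and BD: "satisfies_ids_of S V (B \<times>\<^sub>a D)"
    and AB: "satisfies_ids_of S V (A \<times>\<^sub>a B)"
    using ABCD by (auto intro!: satisfies_ids_prod ids)
  note alg = AC[THEN satisfies_ids_algebra] BD[THEN satisfies_ids_algebra]
    AB[THEN satisfies_ids_algebra]
  \<comment> \<open>The formula is understood only on products of two members of \<open>V\<close>,
    so \<open>A \<times>\<^sub>a C\<close> and \<open>B \<times>\<^sub>a D\<close> are replaced by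
    copies \<open>G\<close> and \<open>H\<close>.\<close>
  obtain G \<alpha> where G: "G \<in> V" and "\<alpha> \<in> iso S (A \<times>\<^sub>a C) G"
    using copy_exists[OF V AC inj_on_subset[OF j subset_UNIV]] .
  then have \<alpha>: "\<alpha> \<in> hom S (A \<times>\<^sub>a C) G" and inj_\<alpha>: "inj_on \<alpha> (carrier (A \<times>\<^sub>a C))"
    unfolding iso_def bij_betw_def by auto
  obtain H \<beta> where H: "H \<in> V" and "\<beta> \<in> iso S (B \<times>\<^sub>a D) H"
    using copy_exists[OF V BD inj_on_subset[OF j subset_UNIV]] .
  then have \<beta>: "\<beta> \<in> hom S (B \<times>\<^sub>a D) H" and inj_\<beta>: "inj_on \<beta> (carrier (B \<times>\<^sub>a D))"
    unfolding iso_def bij_betw_def by auto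
  \<comment> \<open>The graph of \<open>h\<close>, regrouped: \<open>k\<close> collects the first
    coordinates of \<open>x\<close> and \<open>h x\<close>, \<open>l\<close> the second ones, and
    \<open>g\<close> moves both into the copies.\<close>
  define k where "k x = (fst x, fst (h x))" for x
  define l where "l x = (snd x, snd (h x))" for x
  define g where "g x = (\<alpha> (k x), \<beta> (l x))" for x
  have k: "k \<in> hom S (A \<times>\<^sub>a B) (A \<times>\<^sub>a C)" and l: "l \<in> hom S (A \<times>\<^sub>a B) (B \<times>\<^sub>a D)"
    unfolding k_def[abs_def] l_def[abs_def]
    by (auto intro!: pair_hom fst_hom snd_hom hom_comp[OF h fst_hom] hom_comp[OF h snd_hom])
  have g: "g \<in> hom S (A \<times>\<^sub>a B) (G \<times>\<^sub>a H)"
    unfolding g_def[abs_def] by (intro pair_hom hom_comp[OF k \<alpha>] hom_comp[OF l \<beta>])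
  \<comment> \<open>\<open>k\<close> retains the first and \<open>l\<close> the second coordinate of
    the argument, so \<open>g\<close> is injective whether or not \<open>h\<close> is.\<close>
  have inj_g: "inj_on g (carrier (A \<times>\<^sub>a B))"
  proof (rule inj_onI)
    fix u v assume u: "u \<in> carrier (A \<times>\<^sub>a B)" and v: "v \<in> carrier (A \<times>\<^sub>a B)" and "g u = g v"
    then have "k u = k v" "l u = l v"
      using inj_onD[OF inj_\<alpha>] inj_onD[OF inj_\<beta>] hom_closed[OF k] hom_closed[OF l]
      unfolding g_def by blast+
    then show "u = v" unfolding k_def l_def by (simp add: prod_eq_iff)
  qed
  define e where "e = zip (const_tuple A zs) (const_tuple B us)"
  have fst_e: "map fst e = const_tuple A zs" and snd_e: "map snd e = const_tuple B us"
    using len unfolding e_def by simp_all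
  have fst_h: "map (\<lambda>x. fst (h x)) e = const_tuple C zs"
    and snd_h: "map (\<lambda>x. snd (h x)) e = const_tuple D us"
    using map_zip_pair[OF _ h01] len unfolding e_def by simp_all
  \<comment> \<open>The first coordinates of \<open>e\<close> and of its image under
    \<open>h\<close> are both zeros, the second ones both ones. Hence \<open>k\<close> sends
    \<open>e\<close> to the zeros and \<open>l\<close> sends it to the ones.\<close>
  have "map k e = zip (map fst e) (map (\<lambda>x. fst (h x)) e)"
    unfolding k_def[abs_def] by (simp add: zip_map_map zip_same_conv_map)
  also have "\<dots> = const_tuple (A \<times>\<^sub>a C) zs"
    using zs by (simp add: fst_e fst_h const_tuple_prod)
  finally have "map \<alpha> (map k e) = const_tuple G zs"
    using const_tuple_hom[OF alg(1) \<alpha> zs] by simp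
  moreover have "map l e = zip (map snd e) (map (\<lambda>x. snd (h x)) e)"
    unfolding l_def[abs_def] by (simp add: zip_map_map zip_same_conv_map)
  then have "map l e = const_tuple (B \<times>\<^sub>a D) us"
    using us by (simp add: snd_e snd_h const_tuple_prod)
  then have "map \<beta> (map l e) = const_tuple H us"
    using const_tuple_hom[OF alg(2) \<beta> us] by simp
  moreover have "map g e = zip (map \<alpha> (map k e)) (map \<beta> (map l e))"
    unfolding g_def[abs_def] by (simp add: zip_map_map zip_same_conv_map)
  ultimately have g_e: "map g e = zip (const_tuple G zs) (const_tuple H us)" by simp
  have e_carrier: "set e \<subseteq> carrier (A \<times>\<^sub>a B)"
    using const_tuple_closed[OF _ zs, of A] const_tuple_closed[OF _ us, of B]
      satisfies_ids_algebra[OF ids] ABCD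
    unfolding e_def by (auto dest: set_zip_leftD set_zip_rightD)
  have len_e: "length e = length zs" using len by (simp add: e_def)
  have "sat (A \<times>\<^sub>a B) p (\<lambda>i. (e @ [x, y]) ! i)"
    using sat_p[OF ABCD(1,2), of "fst x" "fst y" "snd x" "snd y"] x y xy
    unfolding e_def prod.collapse by (simp add: mem_Times_iff)
  then have "sat (G \<times>\<^sub>a H) p (\<lambda>i. map g (e @ [x, y]) ! i)"
  proof (rule existential_embedding[OF alg(3) g inj_g p(2,1), rotated])
    fix v assume "v \<in> free_vars p"
    then have "v < length (e @ [x, y])" using p(3) len_e by auto
    moreover have "set (e @ [x, y]) \<subseteq> carrier (A \<times>\<^sub>a B)" using e_carrier x y by auto
    ultimately show "(e @ [x, y]) ! v \<in> carrier (A \<times>\<^sub>a B)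
        \<and> map g (e @ [x, y]) ! v = g ((e @ [x, y]) ! v)"
      by (meson nth_map nth_mem subsetD)
  qed
  \<comment> \<open>Over \<open>G\<close> and \<open>H\<close>, the formula asserts equality of the
    second coordinates of \<open>g x\<close> and \<open>g y\<close>.\<close>
  then have "sat (G \<times>\<^sub>a H) p (\<lambda>i. (zip (const_tuple G zs) (const_tuple H us) @
      [(\<alpha> (k x), \<beta> (l x)), (\<alpha> (k y), \<beta> (l y))]) ! i)"
    using g_e by (simp add: g_def)
  then have "\<beta> (l x) = \<beta> (l y)"
    using sat_p[OF G H] x y hom_closed[OF hom_comp[OF k \<alpha>]] hom_closed[OF hom_comp[OF l \<beta>]]
    by blast
  then have "l x = l y" using inj_onD[OF inj_\<beta>] hom_closed[OF l] x y by blast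
  then show ?thesis by (simp add: l_def)
qed

text \<open>RexDFC supplies a formula for the second coordinate only. Conjugating \<open>h\<close>
  with the swap of factors turns \<open>[1, 0]\<close> into \<open>[0, 1]\<close> and exchanges the
  coordinates, which reduces the claim to \<open>hom_respects_snd\<close>.\<close>

lemma hom_respects_fst:
  fixes V :: "('f, 'u) algebra set"
  assumes inf: "infinite (UNIV :: 'u set)" and R: "RexDFC S V zs us"
    and ABCD: "A \<in> V" "B \<in> V" "C \<in> V" "D \<in> V"
    and h: "h \<in> hom S (A \<times>\<^sub>a B) (C \<times>\<^sub>a D)"
    and h10: "map h (zip (const_tuple A us) (const_tuple B zs))
      = zip (const_tuple C us) (const_tuple D zs)"
    and x: "x \<in> carrier (A \<times>\<^sub>a B)" and y: "y \<in> carrier (A \<times>\<^sub>a B)" and xy: "fst x = fst y"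
  shows "fst (h x) = fst (h y)"
proof -
  have swap: "prod.swap \<in> hom S (A' \<times>\<^sub>a B') (B' \<times>\<^sub>a A')" for A' B' :: "('f, 'u) algebra"
    using pair_hom[OF snd_hom fst_hom] by (simp add: prod.swap_def[abs_def])
  define k where "k x = prod.swap (h (prod.swap x))" for x
  have k: "k \<in> hom S (B \<times>\<^sub>a A) (D \<times>\<^sub>a C)"
    unfolding k_def[abs_def] by (rule hom_comp[OF hom_comp[OF swap h] swap])
  have swap_zip: "map prod.swap (zip bs cs) = zip cs bs" for bs cs :: "'u list"
    by (simp add: zip_commute[of cs bs] prod.swap_def[abs_def] case_prod_unfold)
  have "map k (zip (const_tuple B zs) (const_tuple A us))
      = map prod.swap (map h (map prod.swap (zip (const_tuple B zs) (const_tuple A us))))"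
    by (simp add: k_def)
  then have "map k (zip (const_tuple B zs) (const_tuple A us))
      = zip (const_tuple D zs) (const_tuple C us)"
    unfolding swap_zip h10 .
  then have "snd (k (prod.swap x)) = snd (k (prod.swap y))"
    by (rule hom_respects_snd[OF inf R ABCD(2,1,4,3) k]) (use x y xy in auto)
  then show ?thesis by (simp add: k_def)
qed

text \<open>Working up to an isomorphism \<open>g\<close> serves binary products, with
  \<open>g\<close> the identity, as well as \<open>fam_prod\<close> split into one factor and the
  rest. The conclusion presents \<delta> as the kernel of a map that acts coordinatewise.\<close>

lemma congruence_factorizes:
  fixes V :: "('f, 'u) algebra set"
  assumes inf: "infinite (UNIV :: 'u set)" and R: "RexDFC S V zs us"
    and stable: "stable_by_complements S V zs us"
    and AB: "A \<in> V" "B \<in> V" and P: "satisfies_ids_of S V P"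
    and g: "g \<in> iso S P (A \<times>\<^sub>a B)" and \<delta>: "congruence S P \<delta>"
  obtains f\<^sub>1 f\<^sub>2 :: "'u \<Rightarrow> 'u" where
    "\<And>x y. x \<in> carrier P \<Longrightarrow> y \<in> carrier P \<Longrightarrow>
      (x, y) \<in> \<delta> \<longleftrightarrow> f\<^sub>1 (fst (g x)) = f\<^sub>1 (fst (g y)) \<and> f\<^sub>2 (snd (g x)) = f\<^sub>2 (snd (g y))"
proof -
  have V: "variety S V" and len: "length zs = length us"
    and zs: "\<forall>t\<in>set zs. wf_trm S t \<and> vars t = {}" and us: "\<forall>t\<in>set us. wf_trm S t \<and> vars t = {}"
    using R unfolding RexDFC_def variety_with_01_def by auto
  note alg = satisfies_ids_algebra[OF P]
  note ids = variety_iff_satisfies_ids[OF V, THEN iffD1]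
  note algA = ids[OF AB(1), THEN satisfies_ids_algebra]
    and algB = ids[OF AB(2), THEN satisfies_ids_algebra]
  note ids_AB = satisfies_ids_prod[OF ids[OF AB(1)] ids[OF AB(2)]]
  note algAB = satisfies_ids_algebra[OF ids_AB]
  have g_hom: "g \<in> hom S P (A \<times>\<^sub>a B)" and g_bij: "bij_betw g (carrier P) (carrier (A \<times>\<^sub>a B))"
    using g unfolding iso_def by auto
  obtain j :: "'u \<times> 'u \<Rightarrow> 'u" where j: "inj j" using inj_pair_exists[OF inf] .
  have jg: "inj_on (j \<circ> g) (carrier P)"
    using g_bij inj_on_subset[OF j subset_UNIV] by (intro comp_inj_on) (simp_all add: bij_betw_def)
  obtain Q :: "('f, 'u) algebra" and q where q: "q \<in> hom S P Q" "q ` carrier P = carrier Q"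
    and ker: "\<And>x y. x \<in> carrier P \<Longrightarrow> y \<in> carrier P \<Longrightarrow> q x = q y \<longleftrightarrow> (x, y) \<in> \<delta>"
    by (rule quotient_exists[OF alg \<delta> jg]) (rule that)
  have Q: "Q \<in> V" using variety_iff_satisfies_ids[OF V] satisfies_ids_image[OF P q] by blast
  \<comment> \<open>Stability concerns homomorphisms between members of \<open>V\<close>, so the
    quotient map is precomposed with a passage from a copy \<open>P'\<close> of
    \<open>A \<times>\<^sub>a B\<close> in \<open>V\<close>.\<close>
  obtain P' i where P': "P' \<in> V" and i: "i \<in> iso S (A \<times>\<^sub>a B) P'"
    by (rule copy_exists[OF V ids_AB inj_on_subset[OF j subset_UNIV]])
  define i' where "i' = inv_into (carrier (A \<times>\<^sub>a B)) i"
  define g' where "g' = inv_into (carrier P) g"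
  have i': "i' \<in> iso S P' (A \<times>\<^sub>a B)" unfolding i'_def by (rule inv_hom[OF i algAB])
  have g': "g' \<in> hom S (A \<times>\<^sub>a B) P"
    using inv_hom[OF g alg] unfolding g'_def iso_def by blast
  have i'i: "i' (i x) = x" if "x \<in> carrier (A \<times>\<^sub>a B)" for x
    using i that unfolding i'_def iso_def bij_betw_def by auto
  have g'g: "g' (g x) = x" if "x \<in> carrier P" for x
    using g_bij that unfolding g'_def bij_betw_def by auto
  have qi: "(\<lambda>x. q (g' (i' x))) \<in> hom S P' Q"
    using i' by (intro hom_comp[OF _ q(1)] hom_comp[OF _ g']) (simp add: iso_def)
  define e where "e = zip (const_tuple A zs) (const_tuple B us)"
  define e' where "e' = zip (const_tuple A us) (const_tuple B zs)"
  have e: "set e \<subseteq> carrier (A \<times>\<^sub>a B)" "length e = length zs"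
    and e': "set e' \<subseteq> carrier (A \<times>\<^sub>a B)" "length e' = length zs"
    using const_tuple_closed[OF algA zs] const_tuple_closed[OF algA us]
      const_tuple_closed[OF algB zs] const_tuple_closed[OF algB us] len
    unfolding e_def e'_def by (auto dest: set_zip_leftD set_zip_rightD)
  have i'_e: "map i' (map i e) = e" and i'_e': "map i' (map i e') = e'"
    using e e' i'i by (auto intro!: map_idI)
  have "i \<in> hom S (A \<times>\<^sub>a B) P'" using i by (simp add: iso_def)
  then have "set (map i e) \<subseteq> carrier P'" "set (map i e') \<subseteq> carrier P'"
    using e(1) e'(1) hom_closed by fastforce+
  then have "compl_central S V zs us P' (map i e) (map i e')"
    unfolding compl_central_def using AB i' i'_e i'_e' e e' unfolding e_def e'_def
    by (intro conjI bexI[of _ A] bexI[of _ B] bexI[of _ i']) simp_all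
  then have "compl_central S V zs us Q
      (map (\<lambda>x. q (g' (i' x))) (map i e)) (map (\<lambda>x. q (g' (i' x))) (map i e'))"
    using stable P' Q qi unfolding stable_by_complements_def preserves_compl_central_def by blast
  then obtain C D \<tau> where CD: "C \<in> V" "D \<in> V" and \<tau>: "\<tau> \<in> iso S Q (C \<times>\<^sub>a D)"
    and \<tau>e: "map \<tau> (map (\<lambda>x. q (g' (i' x))) (map i e)) = zip (const_tuple C zs) (const_tuple D us)"
    and \<tau>e': "map \<tau> (map (\<lambda>x. q (g' (i' x))) (map i e')) = zip (const_tuple C us) (const_tuple D zs)"
    unfolding compl_central_def by auto
  define h where "h x = \<tau> (q (g' x))" for x
  have h: "h \<in> hom S (A \<times>\<^sub>a B) (C \<times>\<^sub>a D)"
    unfolding h_def[abs_def] using \<tau>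
    by (intro hom_comp[OF hom_comp[OF g' q(1)]]) (simp add: iso_def)
  have "map h e = zip (const_tuple C zs) (const_tuple D us)"
    using \<tau>e e(1) i'i by (simp add: h_def comp_def subset_eq cong: map_cong)
  note snd_eq = hom_respects_snd[OF inf R AB CD h this[unfolded e_def]]
  have "map h e' = zip (const_tuple C us) (const_tuple D zs)"
    using \<tau>e' e'(1) i'i by (simp add: h_def comp_def subset_eq cong: map_cong)
  note fst_eq = hom_respects_fst[OF inf R AB CD h this[unfolded e'_def]]
  \<comment> \<open>Each coordinate of \<open>h\<close> depends on the matching coordinate of the
    argument alone, so the other one may be frozen at an arbitrary base point.\<close>
  obtain a\<^sub>0 b\<^sub>0 where a0: "a\<^sub>0 \<in> carrier A" and b0: "b\<^sub>0 \<in> carrier B"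
    using algA algB unfolding is_algebra_def by blast
  define f\<^sub>1 where "f\<^sub>1 a = fst (h (a, b\<^sub>0))" for a
  define f\<^sub>2 where "f\<^sub>2 b = snd (h (a\<^sub>0, b))" for b
  have h_eq: "h x = (f\<^sub>1 (fst x), f\<^sub>2 (snd x))" if "x \<in> carrier (A \<times>\<^sub>a B)" for x
    using fst_eq[OF that, of "(fst x, b\<^sub>0)"] snd_eq[OF that, of "(a\<^sub>0, snd x)"] that a0 b0
    by (auto simp: f\<^sub>1_def f\<^sub>2_def prod_eq_iff)
  show thesis
  proof (rule that)
    fix x y assume x: "x \<in> carrier P" and y: "y \<in> carrier P"
    have "inj_on \<tau> (carrier Q)" using \<tau> by (simp add: iso_def bij_betw_def)
    then have "(x, y) \<in> \<delta> \<longleftrightarrow> h (g x) = h (g y)"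
      using x y ker q(2) g'g hom_closed[OF q(1)] by (simp add: h_def inj_on_eq_iff)
    then show "(x, y) \<in> \<delta> \<longleftrightarrow> f\<^sub>1 (fst (g x)) = f\<^sub>1 (fst (g y)) \<and> f\<^sub>2 (snd (g x)) = f\<^sub>2 (snd (g y))"
      using h_eq hom_closed[OF g_hom] x y by simp
  qed
qed

text \<open>The complementary factor \<open>B\<close> is the quotient of the product by the common
  kernel of the projections other than the \<open>k\<close>-th. This avoids reindexing and puts
  \<open>B\<close> over \<open>'u\<close>.\<close>

lemma fam_prod_iso:
  fixes V :: "('f, 'u) algebra set"
  assumes inf: "infinite (UNIV :: 'u set)" and V: "variety S V"
    and A: "\<And>i. i < m \<Longrightarrow> A i \<in> V" and k: "k < m"
  obtains B r where "B \<in> V" "(\<lambda>x. (x k, r x)) \<in> iso S (fam_prod m A) (A k \<times>\<^sub>a B)"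
    "\<And>x y. x \<in> carrier (fam_prod m A) \<Longrightarrow> y \<in> carrier (fam_prod m A)
      \<Longrightarrow> r x = r y \<longleftrightarrow> (\<forall>i<m. i \<noteq> k \<longrightarrow> x i = y i)"
proof -
  define P where "P = fam_prod m A"
  have P: "satisfies_ids_of S V P" unfolding P_def
    using A variety_iff_satisfies_ids[OF V] by (intro satisfies_ids_fam_prod) blast
  note alg = satisfies_ids_algebra[OF P]
  obtain j :: "(nat \<Rightarrow> 'u) \<Rightarrow> 'u" where j: "inj_on j (carrier P)"
    using inj_PiE_exists[OF inf, of m "\<lambda>i. carrier (A i)"] unfolding P_def by auto
  define K where "K = {(x, y). x \<in> carrier P \<and> y \<in> carrier P \<and> (\<forall>i\<in>{..<m} - {k}. x i = y i)}"
  have K: "congruence S P K" unfolding K_def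
    by (rule kernel_congruence[where A = A, OF alg]) (auto simp: P_def intro: proj_hom)
  obtain B :: "('f, 'u) algebra" and r where r: "r \<in> hom S P B" "r ` carrier P = carrier B"
    and ker: "\<And>x y. x \<in> carrier P \<Longrightarrow> y \<in> carrier P \<Longrightarrow> r x = r y \<longleftrightarrow> (x, y) \<in> K"
    by (rule quotient_exists[OF alg K j]) (rule that)
  have r_iff: "r x = r y \<longleftrightarrow> (\<forall>i<m. i \<noteq> k \<longrightarrow> x i = y i)"
    if "x \<in> carrier P" "y \<in> carrier P" for x y
    using ker[OF that] that by (auto simp: K_def)
  have B: "B \<in> V" using variety_iff_satisfies_ids[OF V] satisfies_ids_image[OF P r] by blast
  have hom: "(\<lambda>x. (x k, r x)) \<in> hom S P (A k \<times>\<^sub>a B)"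
    using pair_hom[OF proj_hom[OF k] r(1)[unfolded P_def]] unfolding P_def .
  have "inj_on (\<lambda>x. (x k, r x)) (carrier P)"
  proof (rule inj_onI)
    fix x y assume x: "x \<in> carrier P" and y: "y \<in> carrier P" and eq: "(x k, r x) = (y k, r y)"
    then have "\<forall>i<m. x i = y i" using r_iff[OF x y] by auto
    then show "x = y"
      by (intro PiE_ext[of x "{..<m}" "\<lambda>i. carrier (A i)" y]) (use x y in \<open>simp_all add: P_def\<close>)
  qed
  moreover have "ab \<in> (\<lambda>x. (x k, r x)) ` carrier P" if ab: "ab \<in> carrier (A k \<times>\<^sub>a B)" for ab
  \<comment> \<open>Surjectivity: overwriting coordinate \<open>k\<close> of a preimage of the
    second component leaves its value under \<open>r\<close> unchanged.\<close>
  proof -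
    obtain x where x: "x \<in> carrier P" "snd ab = r x" using ab r(2)[symmetric] by auto
    have y: "x(k := fst ab) \<in> carrier P"
      using x(1) ab k by (auto simp: P_def PiE_iff extensional_def)
    have "r (x(k := fst ab)) = r x" using r_iff[OF y x(1)] by simp
    then show ?thesis using y x(2)
      by (intro image_eqI[of _ _ "x(k := fst ab)"]) (simp_all add: prod_eq_iff)
  qed
  ultimately have "(\<lambda>x. (x k, r x)) \<in> iso S P (A k \<times>\<^sub>a B)"
    using hom hom_closed[OF hom] unfolding iso_def bij_betw_def by blast
  then show thesis using that B r_iff unfolding P_def by blast
qed

theorem corollary3:
  fixes S :: "'f signat" and V :: "('f, 'u) algebra set"
    and zs us :: "'f trm list"
  assumes "infinite (UNIV :: 'u set)"
    and "finite (symbols S)"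
    and "RexDFC S V zs us"
    and "stable_by_complements S V zs us"
  shows "fraser_horn S V"
proof -
  note factorizes = congruence_factorizes[OF assms(1,3,4)]
  have V: "variety S V" using assms(3) unfolding RexDFC_def variety_with_01_def by blast
  note ids = variety_iff_satisfies_ids[OF V, THEN iffD1]
  have "\<exists>\<delta>\<^sub>1 \<delta>\<^sub>2. \<delta>\<^sub>1 \<subseteq> carrier A \<times> carrier A \<and> \<delta>\<^sub>2 \<subseteq> carrier B \<times> carrier B \<and>
      \<delta> = {((a, b), (c, d)) | a b c d. (a, c) \<in> \<delta>\<^sub>1 \<and> (b, d) \<in> \<delta>\<^sub>2}"
    if AB: "A \<in> V" "B \<in> V" and \<delta>: "congruence S (A \<times>\<^sub>a B) \<delta>" for A B \<delta>
  proof -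
    have "(\<lambda>x. x) \<in> iso S (A \<times>\<^sub>a B) (A \<times>\<^sub>a B)" by (auto simp: iso_def bij_betw_def intro!: homI)
    then obtain f\<^sub>1 f\<^sub>2 :: "'u \<Rightarrow> 'u" where
      f: "\<And>x y. x \<in> carrier (A \<times>\<^sub>a B) \<Longrightarrow> y \<in> carrier (A \<times>\<^sub>a B) \<Longrightarrow>
        (x, y) \<in> \<delta> \<longleftrightarrow> f\<^sub>1 (fst x) = f\<^sub>1 (fst y) \<and> f\<^sub>2 (snd x) = f\<^sub>2 (snd y)"
      by (rule factorizes[OF AB satisfies_ids_prod[OF AB[THEN ids]] _ \<delta>]) (rule that)
    have sub: "\<delta> \<subseteq> carrier (A \<times>\<^sub>a B) \<times> carrier (A \<times>\<^sub>a B)"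
      using \<delta> unfolding congruence_def by (blast dest: equiv_type)
    \<comment> \<open>The kernels of \<open>f\<^sub>1\<close> and \<open>f\<^sub>2\<close> are cut
      down to the carriers, where alone these functions describe \<delta>.\<close>
    let ?d1 = "{(a, c). a \<in> carrier A \<and> c \<in> carrier A \<and> f\<^sub>1 a = f\<^sub>1 c}"
    let ?d2 = "{(b, d). b \<in> carrier B \<and> d \<in> carrier B \<and> f\<^sub>2 b = f\<^sub>2 d}"
    have "\<delta> = {((a, b), (c, d)) | a b c d. (a, c) \<in> ?d1 \<and> (b, d) \<in> ?d2}"
    proof -
      have "((a, b), (c, d)) \<in> \<delta> \<longleftrightarrow> (a, c) \<in> ?d1 \<and> (b, d) \<in> ?d2" for a b c d
        using f[of "(a, b)" "(c, d)"] sub by auto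
      then show ?thesis by auto
    qed
    then show ?thesis by (intro exI[of _ ?d1] exI[of _ ?d2]) auto
  qed
  moreover have "\<exists>D. (\<forall>i<m. D i \<subseteq> carrier (A i) \<times> carrier (A i)) \<and>
      \<delta> = {(x, y). x \<in> carrier (fam_prod m A) \<and> y \<in> carrier (fam_prod m A) \<and>
                   (\<forall>i<m. (x i, y i) \<in> D i)}"
    if A: "\<forall>i<m. A i \<in> V" and \<delta>: "congruence S (fam_prod m A) \<delta>"
    for m and A :: "nat \<Rightarrow> ('f, 'u) algebra" and \<delta>
  proof -
    define P where "P = fam_prod m A"
    have AV: "A i \<in> V" if "i < m" for i using A that by blast
    have P: "satisfies_ids_of S V P" unfolding P_def by (intro satisfies_ids_fam_prod ids AV)
    have eq: "equiv (carrier P) \<delta>" using \<delta> unfolding congruence_def P_def by blast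
    have sub: "\<delta> \<subseteq> carrier P \<times> carrier P" using eq by (rule equiv_type)
    have trans: "trans \<delta>" using eq by (rule equivE)
    \<comment> \<open>\<open>D i\<close> is the projection of \<delta> to coordinate
      \<open>i\<close>. Pairs in different \<open>D i\<close> may come from different members of
      \<delta>, so coordinates are changed one at a time.\<close>
    define D where "D i = {(u i, v i) | u v. (u, v) \<in> \<delta>}" for i
    have D: "(u i, v i) \<in> D i" if "(u, v) \<in> \<delta>" for u v i using that by (auto simp: D_def)
    \<comment> \<open>Factorize \<delta> along \<open>A k\<close> and the remaining coordinates: the
      \<open>k\<close>-th entries agree under \<open>f\<^sub>1\<close> because \<delta> relates
      \<open>u\<close> and \<open>v\<close>, and the rest does not change.\<close>
    have change_one: "(z, z(k := v k)) \<in> \<delta>"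
      if k: "k < m" and uv: "(u, v) \<in> \<delta>" and z: "z \<in> carrier P" "z k = u k" for k u v z
    proof -
      obtain B r where B: "B \<in> V" "(\<lambda>x. (x k, r x)) \<in> iso S P (A k \<times>\<^sub>a B)"
        and r: "\<And>x y. x \<in> carrier P \<Longrightarrow> y \<in> carrier P
          \<Longrightarrow> r x = r y \<longleftrightarrow> (\<forall>i<m. i \<noteq> k \<longrightarrow> x i = y i)"
        by (rule fam_prod_iso[where A = A, OF assms(1) V AV k, folded P_def], assumption) (rule that)
      note Ak = AV[OF k]
      obtain f\<^sub>1 f\<^sub>2 :: "'u \<Rightarrow> 'u" where f: "\<And>x y. x \<in> carrier P \<Longrightarrow> y \<in> carrier P \<Longrightarrow>
          (x, y) \<in> \<delta> \<longleftrightarrow> f\<^sub>1 (x k) = f\<^sub>1 (y k) \<and> f\<^sub>2 (r x) = f\<^sub>2 (r y)"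
        by (rule factorizes[OF Ak B(1) P B(2) \<delta>[folded P_def], unfolded fst_conv snd_conv])
          (rule that)
      have uvP: "u \<in> carrier P" "v \<in> carrier P" using uv sub by auto
      have z': "z(k := v k) \<in> carrier P"
        using z(1) uvP(2) k by (auto simp: P_def PiE_iff extensional_def)
      have "r (z(k := v k)) = r z" using r[OF z' z(1)] by simp
      moreover have "f\<^sub>1 (u k) = f\<^sub>1 (v k)" using f[OF uvP] uv by blast
      ultimately show ?thesis using f[OF z(1) z'] z(2) by simp
    qed
    have "(x, y) \<in> \<delta>"
      if x: "x \<in> carrier P" and y: "y \<in> carrier P" and xy: "\<forall>i<m. (x i, y i) \<in> D i" for x y
    proof -
      \<comment> \<open>\<open>w k\<close> takes its first \<open>k\<close> coordinates from
        \<open>y\<close> and the others from \<open>x\<close>, so it leads from \<open>x\<close> at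
        \<open>k = 0\<close> to \<open>y\<close> at \<open>k = m\<close>.\<close>
      define w where "w k i = (if i < k then y i else x i)" for k i :: nat
      have w: "w k \<in> carrier P" if "k \<le> m" for k
        using x y that by (auto simp: P_def w_def PiE_iff extensional_def)
      have "(x, w k) \<in> \<delta>" if "k \<le> m" for k
        using that
      proof (induction k)
        case 0
        have "w 0 = x" by (simp add: w_def[abs_def])
        then show ?case using eq x by (auto elim: equivE dest: refl_onD)
      next
        case (Suc k)
        then have k: "k < m" by simp
        then obtain u v where uv: "(u, v) \<in> \<delta>" "x k = u k" "y k = v k"
          using xy unfolding D_def by blast
        have "(w k, (w k)(k := v k)) \<in> \<delta>"
        proof (rule change_one[OF k uv(1)])
          show "w k \<in> carrier P" using w k by simp
          show "w k k = u k" using uv(2) by (simp add: w_def)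
        qed
        moreover have "(w k)(k := v k) = w (Suc k)"
          unfolding w_def[abs_def] uv(3)[symmetric] by (auto simp: less_Suc_eq)
        moreover have "(x, w k) \<in> \<delta>" using Suc by simp
        ultimately show ?case using transD[OF trans] by metis
      qed
      then have "(x, w m) \<in> \<delta>" by simp
      \<comment> \<open>From index \<open>m\<close> on, \<open>w m\<close> still copies
        \<open>x\<close>; there \<open>x\<close> and \<open>y\<close> are both
        \<open>undefined\<close>, by extensionality.\<close>
      moreover have "w m = y"
        by (rule PiE_ext[of _ "{..<m}" "\<lambda>i. carrier (A i)"])
          (use w[of m] y in \<open>simp_all add: P_def, simp add: w_def\<close>)
      ultimately show ?thesis by simp
    qed
    then have "\<delta> = {(x, y). x \<in> carrier P \<and> y \<in> carrier P \<and> (\<forall>i<m. (x i, y i) \<in> D i)}"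
    proof (intro equalityI subrelI)
      fix x y assume "(x, y) \<in> \<delta>"
      then show "(x, y) \<in> {(x, y). x \<in> carrier P \<and> y \<in> carrier P \<and> (\<forall>i<m. (x i, y i) \<in> D i)}"
        using sub D by blast
    qed simp
    moreover have "\<forall>i<m. D i \<subseteq> carrier (A i) \<times> carrier (A i)"
    proof (intro allI impI subrelI)
      fix i a b assume i: "i < m" and "(a, b) \<in> D i"
      then obtain u v where "u \<in> carrier P" "v \<in> carrier P" "a = u i" "b = v i"
        using sub unfolding D_def by blast
      then show "(a, b) \<in> carrier (A i) \<times> carrier (A i)"
        using i by (simp add: P_def PiE_iff)
    qed
    ultimately show ?thesis unfolding P_def by (intro exI[of _ D] conjI)
  qed
  ultimately show ?thesis unfolding fraser_horn_def by (intro conjI ballI allI impI)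
qed

end
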